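(* Let $\alpha$ be a non-negative cone angle on $\mathbb{R}^d$ and $P\subseteq\mathbb{R}^d$ a $d$-polytope. Then, as vectors indexed by $-1,0,\dots,d-1$, $$\widehat\alpha(P)+\widehat\alpha(-P)\in\operatorname{conv}\{f(\partial P)-f(\pi(R,P)) : R\in\mathcal{R}(P)\}.$$
   Context: $\mathcal{C}^d$ is the set of convex polyhedral cones in $\mathbb{R}^d$ with apex at the origin. A valuation $\alpha:\mathcal{C}^d\to\mathbb{R}$ satisfies $\alpha(C\cup C')=\alpha(C)+\alpha(C')-\alpha(C\cap C')$ whenever $C,C',C\cup C'\in\mathcal{C}^d$; a cone angle is a valuation with $\alpha(C)=0$ for $\dim C<d$ and $\alpha(\mathbb{R}^d)=1$; non-negative means $\alpha\ge0$. For a nonempty face $F$, $T_FP=\{x: q+\varepsilon x\in P\text{ for some }\varepsilon>0\}$ for $q$ in the relative interior of $F$, and $T_\emptyset P=\{0\}$. The vector $\widehat\alpha(P)=(\widehat\alpha_{-1}(P),\dots,\widehat\alpha_{d-1}(P))$ has $\widehat\alpha_i(P)=\sum_{F\text{ an }i\text{-face}}\alpha(T_FP)$ for $0\le i\le d-1$ and $\widehat\alpha_{-1}(P)=0$; $-P=\{-x:x\in P\}$. Write $P=\{x:\langle a_k,x\rangle\le b_k,\ k=1..n\}$ with facet-defining hyperplanes; $\mathcal{R}(P)$ is the set of closures of connected components of $\mathbb{R}^d\setminus\bigcup_k\{x:\langle a_k,x\rangle=0\}$. $\partial P$ is the set of all faces of $P$ other than $P$, including $\emptyset$, and $\pi(R,P)=\{F\in\partial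 P: R\not\subseteq T_FP\text{ and }-R\not\subseteq T_FP\}$. For a finite set $\Pi$ of polytopes, $f(\Pi)=(f_{-1}(\Pi),\dots,f_{d-1}(\Pi))$ with $f_i(\Pi)$ the number of $i$-dimensional members of $\Pi$ (the empty face having dimension $-1$). *)

theory Defs
  imports "HOL-Analysis.Analysis" "HOL-Library.Function_Algebras"
begin

text \<open>The vectors indexed by \<open>-1, 0, \<dots>, d - 1\<close> are functions of type \<open>int \<Rightarrow> real\<close> that vanish
  outside this range. The pointwise real vector space structure on functions makes the library's
  convex hull applicable to them.\<close>

instantiation "fun" :: (type, real_vector) real_vector
begin

definition scaleR_fun :: "real \<Rightarrow> ('a \<Rightarrow> 'b) \<Rightarrow> 'a \<Rightarrow> 'b"
  where "scaleR_fun c f = (\<lambda>x. c *\<^sub>R f x)"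

instance
  by standard (auto simp: scaleR_fun_def fun_eq_iff scaleR_add_right scaleR_add_left)

end

definition polyhedral_cones :: "'a::euclidean_space set set"
  where "polyhedral_cones = {C. C \<noteq> {} \<and> polyhedron C \<and> cone C}"

definition cone_valuation :: "('a::euclidean_space set \<Rightarrow> real) \<Rightarrow> bool"
  where "cone_valuation \<alpha> \<longleftrightarrow>
    (\<forall>C\<in>polyhedral_cones. \<forall>C'\<in>polyhedral_cones. C \<union> C' \<in> polyhedral_cones \<longrightarrow>
       \<alpha> (C \<union> C') = \<alpha> C + \<alpha> C' - \<alpha> (C \<inter> C'))"

definition cone_angle :: "('a::euclidean_space set \<Rightarrow> real) \<Rightarrow> bool"
  where "cone_angle \<alpha> \<longleftrightarrow> cone_valuation \<alpha> \<and>
    (\<forall>C\<in>polyhedral_cones. aff_dim C < int DIM('a) \<longrightarrow> \<alpha> C = 0) \<and> \<alpha> UNIV = 1"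

definition nonneg_cone_angle :: "('a::euclidean_space set \<Rightarrow> real) \<Rightarrow> bool"
  where "nonneg_cone_angle \<alpha> \<longleftrightarrow> cone_angle \<alpha> \<and> (\<forall>C\<in>polyhedral_cones. 0 \<le> \<alpha> C)"

definition tangent_cone :: "'a::euclidean_space set \<Rightarrow> 'a set \<Rightarrow> 'a set"
  where "tangent_cone F P =
    (if F = {} then {0}
     else let q = SOME q. q \<in> rel_interior F in {x. \<exists>\<epsilon>>0. q + \<epsilon> *\<^sub>R x \<in> P})"

lemma tangent_cone_subset:
  fixes P :: "'a::euclidean_space set"
  assumes "convex P" "F face_of P" "q \<in> rel_interior F" "q' \<in> rel_interior F"
  shows "{x. \<exists>\<epsilon>>0. q + \<epsilon> *\<^sub>R x \<in> P} \<subseteq> {x. \<exists>\<epsilon>>0. q' + \<epsilon> *\<^sub>R x \<in> P}"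
proof clarify
  fix \<epsilon> :: real and y :: 'a
  assume e: "0 < \<epsilon>" "q + \<epsilon> *\<^sub>R y \<in> P"
  have "convex F" "F \<subseteq> P" using assms(2) by (auto simp: face_of_def)
  have "F \<noteq> {}" "q \<in> F" using assms(3) rel_interior_subset by auto
  then obtain m where m: "m > 1" "(1 - m) *\<^sub>R q + m *\<^sub>R q' \<in> F"
    using convex_rel_interior_iff[OF \<open>convex F\<close> \<open>F \<noteq> {}\<close>, of q'] assms(4) by blast
  let ?r = "(1 - m) *\<^sub>R q + m *\<^sub>R q'"
  have "(1 - 1 / m) *\<^sub>R (q + \<epsilon> *\<^sub>R y) + (1 / m) *\<^sub>R ?r \<in> P"
    using convexD[OF assms(1) e(2) subsetD[OF \<open>F \<subseteq> P\<close> m(2)], of "1 - 1 / m" "1 / m"] m(1) by simp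
  moreover have "(1 - 1 / m) *\<^sub>R (q + \<epsilon> *\<^sub>R y) + (1 / m) *\<^sub>R ?r = q' + ((1 - 1 / m) * \<epsilon>) *\<^sub>R y"
  proof -
    have "(1 / m) *\<^sub>R ?r = (1 / m - 1) *\<^sub>R q + q'"
      using m by (simp add: scaleR_add_right diff_divide_distrib)
    then show ?thesis by (simp add: algebra_simps)
  qed
  moreover have "(1 - 1 / m) * \<epsilon> > 0" using m e by simp
  ultimately show "\<exists>\<epsilon>>0. q' + \<epsilon> *\<^sub>R y \<in> P"
    by (intro exI[of _ "(1 - 1 / m) * \<epsilon>"]) simp
qed

text \<open>The choice of the point \<open>q\<close> is immaterial.\<close>

lemma tangent_cone_eq:
  fixes P :: "'a::euclidean_space set"
  assumes "convex P" "F face_of P" "q \<in> rel_interior F"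
  shows "tangent_cone F P = {x. \<exists>\<epsilon>>0. q + \<epsilon> *\<^sub>R x \<in> P}"
proof -
  have "F \<noteq> {}" using assms(3) by auto
  moreover have "(SOME q. q \<in> rel_interior F) \<in> rel_interior F" using assms(3) by (rule someI)
  ultimately show ?thesis
    using tangent_cone_subset[OF assms(1,2,3), of "SOME q. q \<in> rel_interior F"]
      tangent_cone_subset[OF assms(1,2) _ assms(3), of "SOME q. q \<in> rel_interior F"]
    unfolding tangent_cone_def Let_def by (simp add: subset_antisym)
qed

definition angle_vector :: "('a::euclidean_space set \<Rightarrow> real) \<Rightarrow> 'a set \<Rightarrow> int \<Rightarrow> real"
  where "angle_vector \<alpha> P i =
    (if 0 \<le> i \<and> i \<le> int DIM('a) - 1
     then \<Sum>F\<in>{F. F face_of P \<and> aff_dim F = i}. \<alpha> (tangent_cone F P) else 0)"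

definition facet_normals :: "'a::euclidean_space set \<Rightarrow> 'a set"
  where "facet_normals P =
    {a. a \<noteq> 0 \<and> (\<exists>b. P \<subseteq> {x. a \<bullet> x \<le> b} \<and> P \<inter> {x. a \<bullet> x = b} facet_of P)}"

definition regions :: "'a::euclidean_space set \<Rightarrow> 'a set set"
  where "regions P = closure ` components (- (\<Union>a\<in>facet_normals P. {x. a \<bullet> x = 0}))"

text \<open>Positive multiples of a normal vector define the same hyperplane, so the regions can be
  computed from any description of the polytope by facet-defining inequalities.\<close>

lemma regions_eq:
  fixes P :: "'a::euclidean_space set" and a :: "nat \<Rightarrow> 'a" and b :: "nat \<Rightarrow> real"
  assumes P: "P = {x. \<forall>k\<in>{1..n}. a k \<bullet> x \<le> b k}"
    and facet: "\<And>k. k \<in> {1..n} \<Longrightarrow> P \<inter> {x. a k \<bullet> x = b k} facet_of P"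
    and full: "aff_dim P = int DIM('a)"
  shows "regions P = closure ` components (- (\<Union>k\<in>{1..n}. {x. a k \<bullet> x = 0}))"
proof -
  have a0: "a k \<noteq> 0" if k: "k \<in> {1..n}" for k
  proof
    assume "a k = 0"
    with facet[OF k] have "P \<inter> {x. a k \<bullet> x = b k} = P"
      by (auto simp: facet_of_def)
    with facet[OF k] show False by (simp add: facet_of_def)
  qed
  have hull: "affine hull (P \<inter> {x. c \<bullet> x = \<beta>}) = {x. c \<bullet> x = \<beta>}"
    if "c \<noteq> 0" "P \<inter> {x. c \<bullet> x = \<beta>} facet_of P" for c \<beta>
  proof -
    have "aff_dim (P \<inter> {x. c \<bullet> x = \<beta>}) = aff_dim {x. c \<bullet> x = \<beta>}"
      using that full by (simp add: facet_of_def aff_dim_hyperplane)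
    then have "affine hull (P \<inter> {x. c \<bullet> x = \<beta>}) = affine hull {x. c \<bullet> x = \<beta>}"
      by (intro aff_dim_eq_full_gen[THEN iffD1]) auto
    then show ?thesis by (simp add: affine_hyperplane affine_hull_eq)
  qed
  have "\<exists>k\<in>{1..n}. {x. c \<bullet> x = 0} = {x. a k \<bullet> x = 0}" if c: "c \<in> facet_normals P" for c
  proof -
    obtain \<beta> where c0: "c \<noteq> 0" and sub: "P \<subseteq> {x. c \<bullet> x \<le> \<beta>}"
      and cf: "P \<inter> {x. c \<bullet> x = \<beta>} facet_of P" (is "?F facet_of P")
      using c by (auto simp: facet_normals_def)
    have Fconv: "convex ?F" and "?F \<noteq> {}"
      using cf by (auto simp: facet_of_def face_of_def)
    then obtain q where q: "q \<in> rel_interior ?F" using rel_interior_eq_empty by blast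
    then have qF: "q \<in> ?F" using rel_interior_subset by blast
    have "\<exists>k\<in>{1..n}. a k \<bullet> q = b k"
    proof (rule ccontr)
      assume "\<not> ?thesis"
      then have "q \<in> {x. \<forall>k\<in>{1..n}. a k \<bullet> x < b k}" (is "_ \<in> ?I")
        using qF P by force
      moreover have "open ?I"
      proof -
        have "?I = (\<Inter>k\<in>{1..n}. {x. a k \<bullet> x < b k})" by auto
        then show ?thesis by (simp add: open_halfspace_lt open_INT)
      qed
      moreover have "?I \<subseteq> {x. c \<bullet> x \<le> \<beta>}" using sub P by force
      ultimately have "q \<in> interior {x. c \<bullet> x \<le> \<beta>}" by (meson interiorI)
      then show False using qF c0 by simp
    qed
    then obtain k where k: "k \<in> {1..n}" "a k \<bullet> q = b k" by blast
    have "?F \<subseteq> P \<inter> {x. a k \<bullet> x = b k}"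
    proof (rule subset_of_face_of)
      show "P \<inter> {x. a k \<bullet> x = b k} face_of P" using facet[OF k(1)] by (simp add: facet_of_def)
      show "(P \<inter> {x. a k \<bullet> x = b k}) \<inter> rel_interior ?F \<noteq> {}"
        using q qF k by blast
    qed auto
    then have "affine hull ?F = affine hull (P \<inter> {x. a k \<bullet> x = b k})"
      using cf facet[OF k(1)] by (intro aff_dim_eq_full_gen[THEN iffD1]) (auto simp: facet_of_def)
    then have eq: "{x. c \<bullet> x = \<beta>} = {x. a k \<bullet> x = b k}"
      using hull[OF c0 cf] hull[OF a0[OF k(1)] facet[OF k(1)]] by simp
    have "c \<bullet> x = 0 \<longleftrightarrow> a k \<bullet> x = 0" for x
    proof -
      have "c \<bullet> (q + x) = \<beta> \<longleftrightarrow> a k \<bullet> (q + x) = b k" using eq by blast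
      then show ?thesis using qF k by (simp add: inner_add_right)
    qed
    then show ?thesis using k by auto
  qed
  moreover have "a k \<in> facet_normals P" if "k \<in> {1..n}" for k
    using a0[OF that] facet[OF that] that P unfolding facet_normals_def by blast
  ultimately have "(\<Union>a\<in>facet_normals P. {x. a \<bullet> x = 0}) = (\<Union>k\<in>{1..n}. {x. a k \<bullet> x = 0})"
    by blast
  then show ?thesis by (simp add: regions_def)
qed

definition proper_faces :: "'a::euclidean_space set \<Rightarrow> 'a set set"
  where "proper_faces P = {F. F face_of P \<and> F \<noteq> P}"

definition cut_faces :: "'a::euclidean_space set \<Rightarrow> 'a set \<Rightarrow> 'a set set"
  where "cut_faces R P =
    {F \<in> proper_faces P. \<not> R \<subseteq> tangent_cone F P \<and> \<not> uminus ` R \<subseteq> tangent_cone F P}"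

definition f_vector :: "'a::euclidean_space set set \<Rightarrow> int \<Rightarrow> real"
  where "f_vector S i =
    (if -1 \<le> i \<and> i \<le> int DIM('a) - 1 then real (card {F \<in> S. aff_dim F = i}) else 0)"

end

theory Submission
  imports Defs
begin

text \<open>Cutting a polyhedral cone along the hyperplanes \<open>\<langle>a\<^sub>k, x\<rangle> = 0\<close> one at a time, the valuation
  property expresses its angle as the sum of the angles of the pieces, because the overlaps are
  lower-dimensional. Each tangent cone \<open>T\<^sub>F P\<close> and its negative \<open>-T\<^sub>F P\<close> is cut out by some of these
  hyperplanes, so its angle is the sum of \<open>\<alpha>(R)\<close> over the regions \<open>R\<close> contained in it. For a proper
  nonempty face \<open>F\<close>, the cone \<open>T\<^sub>F P\<close> cannot contain both \<open>R\<close> and \<open>-R\<close>. Hence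
  \<open>\<alpha>(T\<^sub>F P) + \<alpha>(-T\<^sub>F P)\<close> is the sum of \<open>\<alpha>(R)\<close> over the regions with \<open>F \<notin> \<pi>(R, P)\<close>, and summation
  over \<open>F\<close> exhibits the angle vector as the convex combination with weights \<open>\<alpha>(R)\<close>.\<close>

lemma sum_fun_apply: "(\<Sum>x\<in>A. f x) i = (\<Sum>x\<in>A. f x i)"
  for f :: "'b \<Rightarrow> 'c \<Rightarrow> 'd::comm_monoid_add"
  by (induction A rule: infinite_finite_induct) auto

section \<open>Cones cut out by finitely many hyperplanes\<close>

definition halfspace_cone :: "('i \<Rightarrow> 'a::euclidean_space) \<Rightarrow> 'i set \<Rightarrow> 'a set"
  where "halfspace_cone v K = {x. \<forall>k\<in>K. v k \<bullet> x \<le> 0}"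

definition open_halfspace_cone :: "('i \<Rightarrow> 'a::euclidean_space) \<Rightarrow> 'i set \<Rightarrow> 'a set"
  where "open_halfspace_cone v K = {x. \<forall>k\<in>K. v k \<bullet> x < 0}"

text \<open>Sign vectors are encoded as index sets: \<open>S\<close> holds the indices where a cell
  lies on the side \<open>a k \<bullet> x \<le> 0\<close>. All candidate cells are thus indexed by
  \<open>Pow I\<close>, including degenerate ones.\<close>

definition orient :: "('i \<Rightarrow> 'a::euclidean_space) \<Rightarrow> 'i set \<Rightarrow> 'i \<Rightarrow> 'a"
  where "orient a S k = (if k \<in> S then a k else - a k)"

lemma polyhedral_cone_Int:
  assumes "C \<in> polyhedral_cones" "D \<in> polyhedral_cones"
  shows "C \<inter> D \<in> polyhedral_cones"
proof -
  have "0 \<in> C" "0 \<in> D" using assms cone_contains_0 by (auto simp: polyhedral_cones_def)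
  then show ?thesis using assms by (auto simp: polyhedral_cones_def cone_def)
qed

lemma halfspace_cone_polyhedral:
  assumes "finite K" shows "halfspace_cone v K \<in> polyhedral_cones"
proof -
  have "halfspace_cone v K = \<Inter> ((\<lambda>k. {x. v k \<bullet> x \<le> 0}) ` K)"
    by (auto simp: halfspace_cone_def)
  also have "polyhedron \<dots>" using assms by (intro polyhedron_Inter) (auto simp: polyhedron_halfspace_le)
  finally have "polyhedron (halfspace_cone v K)" .
  moreover have "0 \<in> halfspace_cone v K" by (simp add: halfspace_cone_def)
  moreover have "cone (halfspace_cone v K)"
    by (auto simp: cone_def halfspace_cone_def mult_nonneg_nonpos)
  ultimately show ?thesis by (auto simp: polyhedral_cones_def)
qed

text \<open>Adding ever smaller positive multiples of one point \<open>y\<close> of the open cone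
  pushes any point of the closed cone into the open one. Nonemptiness matters: the closed cone
  always contains 0, even if the open one is empty.\<close>

lemma closure_open_halfspace_cone:
  assumes "finite K" "open_halfspace_cone v K \<noteq> {}"
  shows "closure (open_halfspace_cone v K) = halfspace_cone v K"
proof
  have "closed (halfspace_cone v K)"
    using halfspace_cone_polyhedral[OF assms(1), of v]
    by (auto simp: polyhedral_cones_def polyhedron_imp_closed)
  moreover have "open_halfspace_cone v K \<subseteq> halfspace_cone v K"
    by (auto simp: open_halfspace_cone_def halfspace_cone_def less_imp_le)
  ultimately show "closure (open_halfspace_cone v K) \<subseteq> halfspace_cone v K"
    by (rule closure_minimal[rotated])
next
  obtain y where y: "y \<in> open_halfspace_cone v K" using assms(2) by blast
  show "halfspace_cone v K \<subseteq> closure (open_halfspace_cone v K)"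
  proof
    fix x assume x: "x \<in> halfspace_cone v K"
    have "x + (1 / real (Suc n)) *\<^sub>R y \<in> open_halfspace_cone v K" for n
      using x y by (fastforce simp: open_halfspace_cone_def halfspace_cone_def inner_add_right
          intro: add_nonpos_neg divide_neg_pos)
    moreover have "(\<lambda>n. x + (1 / real (Suc n)) *\<^sub>R y) \<longlonglongrightarrow> x + 0 *\<^sub>R y"
      by (intro tendsto_intros LIMSEQ_Suc[OF lim_1_over_n])
    ultimately show "x \<in> closure (open_halfspace_cone v K)"
      unfolding closure_sequential
      by (intro exI[of _ "\<lambda>n. x + (1 / real (Suc n)) *\<^sub>R y"]) simp
  qed
qed

text \<open>An interior point of the cone is interior to each bounding half-space. This shows that a
  cell whose strict inequalities are unsolvable has no interior, hence angle 0.\<close>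

lemma interior_halfspace_cone_subset:
  assumes "\<And>k. k \<in> K \<Longrightarrow> v k \<noteq> 0"
  shows "interior (halfspace_cone v K) \<subseteq> open_halfspace_cone v K"
proof
  fix x assume x: "x \<in> interior (halfspace_cone v K)"
  have "v k \<bullet> x < 0" if "k \<in> K" for k
  proof -
    have "halfspace_cone v K \<subseteq> {x. v k \<bullet> x \<le> 0}"
      using that by (auto simp: halfspace_cone_def)
    then have "x \<in> interior {x. v k \<bullet> x \<le> 0}" using x interior_mono by blast
    then show ?thesis using assms[OF that] by simp
  qed
  then show "x \<in> open_halfspace_cone v K" by (simp add: open_halfspace_cone_def)
qed

text \<open>The relative interior of a nonempty convex set is nonempty, and in full dimension it is
  the interior. Empty interior therefore forces lower dimension.\<close>

lemma cone_angle_eq_0_if_interior_empty: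
  fixes \<alpha> :: "'a::euclidean_space set \<Rightarrow> real"
  assumes "cone_angle \<alpha>" "C \<in> polyhedral_cones" "interior C = {}"
  shows "\<alpha> C = 0"
proof -
  have "rel_interior C \<noteq> {}"
    using assms(2) rel_interior_eq_empty polyhedron_imp_convex
    by (auto simp: polyhedral_cones_def)
  then have "aff_dim C \<noteq> int DIM('a)"
    using assms(3) interior_rel_interior_gen[of C] by auto
  moreover have "aff_dim C \<le> int DIM('a)" by (rule aff_dim_le_DIM)
  ultimately show ?thesis using assms(1,2) by (auto simp: cone_angle_def)
qed

lemma cone_angle_cut:
  fixes \<alpha> :: "'a::euclidean_space set \<Rightarrow> real"
  assumes \<alpha>: "cone_angle \<alpha>" and C: "C \<in> polyhedral_cones" and a: "a \<noteq> 0"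
  shows "\<alpha> C = \<alpha> (C \<inter> {x. a \<bullet> x \<le> 0}) + \<alpha> (C \<inter> {x. - a \<bullet> x \<le> 0})"
proof -
  \<comment> \<open>A half-space is the cone of a family indexed by a single point.\<close>
  have H: "{x. c \<bullet> x \<le> 0} \<in> polyhedral_cones" for c :: 'a
    using halfspace_cone_polyhedral[of "{()}" "\<lambda>_. c"] by (simp add: halfspace_cone_def)
  let ?A = "C \<inter> {x. a \<bullet> x \<le> 0}" and ?B = "C \<inter> {x. - a \<bullet> x \<le> 0}"
  have AB: "?A \<in> polyhedral_cones" "?B \<in> polyhedral_cones"
    using C H by (auto intro: polyhedral_cone_Int simp del: inner_minus_left)
  have "?A \<union> ?B = C" by auto
  then have "\<alpha> C = \<alpha> ?A + \<alpha> ?B - \<alpha> (?A \<inter> ?B)"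
    using \<alpha> AB C unfolding cone_angle_def cone_valuation_def by metis
  moreover have "\<alpha> (?A \<inter> ?B) = 0"
  proof (rule cone_angle_eq_0_if_interior_empty[OF \<alpha>])
    show "?A \<inter> ?B \<in> polyhedral_cones" using AB by (rule polyhedral_cone_Int)
    have "?A \<inter> ?B \<subseteq> {x. a \<bullet> x = 0}" by auto
    then show "interior (?A \<inter> ?B) = {}"
      using interior_mono interior_hyperplane[OF a, of 0] by blast
  qed
  ultimately show ?thesis by simp
qed

text \<open>Induction on the hyperplanes: the new index \<open>j\<close> cuts the cell of
  \<open>S\<close> into those of \<open>insert j S\<close> and \<open>S\<close>. Degenerate cells
  stay in the sum, so that the induction runs over the full power set.\<close>

lemma cone_angle_sum_cells:
  fixes \<alpha> :: "'a::euclidean_space set \<Rightarrow> real"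
  assumes "finite I" and \<alpha>: "cone_angle \<alpha>" and C: "C \<in> polyhedral_cones"
    and "\<And>k. k \<in> I \<Longrightarrow> a k \<noteq> 0"
  shows "\<alpha> C = (\<Sum>S\<in>Pow I. \<alpha> (C \<inter> halfspace_cone (orient a S) I))"
  using assms(1,4)
proof (induction I rule: finite_induct)
  case empty
  then show ?case by (simp add: halfspace_cone_def)
next
  case (insert j I)
  let ?D = "\<lambda>S. C \<inter> halfspace_cone (orient a S) I"
  let ?E = "\<lambda>S. C \<inter> halfspace_cone (orient a S) (insert j I)"
  have split: "\<alpha> (?D S) = \<alpha> (?E (insert j S)) + \<alpha> (?E S)" if "S \<in> Pow I" for S
  proof -
    have "?D S \<in> polyhedral_cones"
      using C insert.hyps by (intro polyhedral_cone_Int halfspace_cone_polyhedral)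
    then have "\<alpha> (?D S) = \<alpha> (?D S \<inter> {x. a j \<bullet> x \<le> 0}) + \<alpha> (?D S \<inter> {x. - a j \<bullet> x \<le> 0})"
      using insert.prems by (intro cone_angle_cut \<alpha>) auto
    \<comment> \<open>As \<open>j\<close> lies outside \<open>I\<close>, putting it into
      \<open>S\<close> leaves the orientation of the hyperplanes in \<open>I\<close>
      unchanged.\<close>
    moreover have "?D S \<inter> {x. a j \<bullet> x \<le> 0} = ?E (insert j S)"
      using that insert.hyps by (force simp: halfspace_cone_def orient_def)
    moreover have "?D S \<inter> {x. - a j \<bullet> x \<le> 0} = ?E S"
      using that insert.hyps by (auto simp: halfspace_cone_def orient_def)
    ultimately show ?thesis by simp
  qed
  have "inj_on (insert j) (Pow I)"
    using insert.hyps by (auto simp: inj_on_def)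
  moreover have "Pow I \<inter> insert j ` Pow I = {}" using insert.hyps by auto
  ultimately have "(\<Sum>S\<in>Pow (insert j I). \<alpha> (?E S)) = (\<Sum>S\<in>Pow I. \<alpha> (?E S) + \<alpha> (?E (insert j S)))"
    using insert.hyps by (simp add: Pow_insert sum.union_disjoint sum.reindex sum.distrib)
  also have "\<dots> = (\<Sum>S\<in>Pow I. \<alpha> (?D S))" by (intro sum.cong) (auto simp: split)
  also have "\<dots> = \<alpha> C" using insert by simp
  finally show ?case by simp
qed

section \<open>Regions of a hyperplane arrangement\<close>

text \<open>The nonempty open cells are convex, hence connected, and they partition the complement
  of the hyperplanes. A disjoint family of nonempty open connected sets with this union must be the
  family of components.\<close>

lemma components_hyperplane_arrangement:
  fixes a :: "'i \<Rightarrow> 'a::euclidean_space"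
  assumes "finite I"
  shows "components (- (\<Union>k\<in>I. {x. a k \<bullet> x = 0})) =
    (\<lambda>S. open_halfspace_cone (orient a S) I) ` {S \<in> Pow I. open_halfspace_cone (orient a S) I \<noteq> {}}"
proof (rule components_open_unique)
  let ?O = "\<lambda>S. open_halfspace_cone (orient a S) I"
  let ?\<S> = "{S \<in> Pow I. ?O S \<noteq> {}}"
  show "disjoint (?O ` ?\<S>)"
  proof (rule disjointI)
    fix X Y assume XY: "X \<in> ?O ` ?\<S>" "Y \<in> ?O ` ?\<S>" "X \<noteq> Y"
    then obtain S T where ST: "S \<subseteq> I" "T \<subseteq> I" "X = ?O S" "Y = ?O T" "S \<noteq> T" by auto
    then obtain k where "k \<in> I" "k \<in> S \<longleftrightarrow> k \<notin> T" by blast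
    then show "X \<inter> Y = {}"
      using ST(3,4) by (force simp: open_halfspace_cone_def orient_def split: if_splits)
  qed
  show "\<Union> (?O ` ?\<S>) = - (\<Union>k\<in>I. {x. a k \<bullet> x = 0})" (is "_ = ?U")
  proof
    show "\<Union> (?O ` ?\<S>) \<subseteq> ?U"
      by (force simp: open_halfspace_cone_def orient_def split: if_splits)
    show "?U \<subseteq> \<Union> (?O ` ?\<S>)"
    proof
      fix x assume "x \<in> ?U"
      \<comment> \<open>The cell of \<open>x\<close> is given by its own sign pattern; no sign is
        zero off the hyperplanes.\<close>
      then have "x \<in> ?O {k \<in> I. a k \<bullet> x < 0}"
        by (force simp: open_halfspace_cone_def orient_def)
      moreover from this have "{k \<in> I. a k \<bullet> x < 0} \<in> ?\<S>" by auto
      ultimately show "x \<in> \<Union> (?O ` ?\<S>)" by (rule UN_I[rotated])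
    qed
  qed
  fix X assume "X \<in> ?O ` ?\<S>"
  then obtain S where S: "X = ?O S" "X \<noteq> {}" by blast
  then have X: "X = (\<Inter>k\<in>I. {x. orient a S k \<bullet> x < 0})"
    by (auto simp: open_halfspace_cone_def)
  have "open X" unfolding X using assms by (intro open_INT) (auto simp: open_halfspace_lt)
  moreover have "convex X" unfolding X by (intro convex_INT convex_halfspace_lt)
  ultimately show "open X \<and> connected X \<and> X \<noteq> {}" using S convex_connected by blast
qed

lemma closure_components_hyperplane_arrangement:
  fixes a :: "'i \<Rightarrow> 'a::euclidean_space"
  assumes "finite I"
  shows "closure ` components (- (\<Union>k\<in>I. {x. a k \<bullet> x = 0})) =
    (\<lambda>S. halfspace_cone (orient a S) I) ` {S \<in> Pow I. open_halfspace_cone (orient a S) I \<noteq> {}}"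
  unfolding components_hyperplane_arrangement[OF assms] image_image
  by (intro image_cong) (auto simp: closure_open_halfspace_cone[OF assms])

text \<open>A point of the open cell of \<open>S\<close> has strict signs, so it lies in the closed
  cell of \<open>T\<close> only if \<open>T\<close> prescribes the same signs. This turns sums over
  sign patterns into sums over the set of regions.\<close>

lemma inj_on_halfspace_cone_orient:
  "inj_on (\<lambda>S. halfspace_cone (orient a S) I) {S \<in> Pow I. open_halfspace_cone (orient a S) I \<noteq> {}}"
proof (rule inj_onI, rule ccontr)
  fix S T
  assume S: "S \<in> {S \<in> Pow I. open_halfspace_cone (orient a S) I \<noteq> {}}"
    and T: "T \<in> {S \<in> Pow I. open_halfspace_cone (orient a S) I \<noteq> {}}"
    and eq: "halfspace_cone (orient a S) I = halfspace_cone (orient a T) I" and ne: "S \<noteq> T"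
  obtain x where x: "x \<in> open_halfspace_cone (orient a S) I" using S by blast
  then have "x \<in> halfspace_cone (orient a S) I"
    by (auto simp: open_halfspace_cone_def halfspace_cone_def less_imp_le)
  then have xT: "x \<in> halfspace_cone (orient a T) I" using eq by simp
  obtain k where "k \<in> I" "k \<in> S \<longleftrightarrow> k \<notin> T" using S T ne by blast
  then show False
    using x xT by (force simp: open_halfspace_cone_def halfspace_cone_def orient_def split: if_splits)
qed

text \<open>The free choice of sign in \<open>v\<close> covers tangent cones and their negatives
  alike; \<open>K = {}\<close> gives the whole space. A full-dimensional cell either lies in the
  cone or meets it only within a hyperplane.\<close>

lemma cone_angle_sum_regions:
  fixes \<alpha> :: "'a::euclidean_space set \<Rightarrow> real" and a v :: "'i \<Rightarrow> 'a"
  assumes I: "finite I" and \<alpha>: "cone_angle \<alpha>" and a0: "\<And>k. k \<in> I \<Longrightarrow> a k \<noteq> 0"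
    and K: "K \<subseteq> I" and v: "\<And>k. k \<in> K \<Longrightarrow> v k = a k \<or> v k = - a k"
  shows "\<alpha> (halfspace_cone v K) =
    (\<Sum>R\<in>closure ` components (- (\<Union>k\<in>I. {x. a k \<bullet> x = 0})).
       if R \<subseteq> halfspace_cone v K then \<alpha> R else 0)"
proof -
  let ?O = "\<lambda>S. open_halfspace_cone (orient a S) I"
  let ?C = "\<lambda>S. halfspace_cone (orient a S) I"
  let ?T = "halfspace_cone v K"
  have or0: "orient a S k \<noteq> 0" if "k \<in> I" for S k
    using a0[OF that] by (simp add: orient_def)
  have T: "?T \<in> polyhedral_cones" and C: "?C S \<in> polyhedral_cones" for S
    using I K by (auto intro: halfspace_cone_polyhedral finite_subset)
  then have TC: "?T \<inter> ?C S \<in> polyhedral_cones" for S by (intro polyhedral_cone_Int)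
  have intC: "interior (?C S) \<subseteq> ?O S" for S
    using or0 by (rule interior_halfspace_cone_subset)
  have empty: "\<alpha> (?T \<inter> ?C S) = 0" if "?O S = {}" for S
    using intC[of S] that by (intro cone_angle_eq_0_if_interior_empty[OF \<alpha> TC]) auto
  have outside: "\<alpha> (?T \<inter> ?C S) = 0" if S: "\<not> ?C S \<subseteq> ?T" for S
  proof -
    obtain x k where x: "x \<in> ?C S" and k: "k \<in> K" "v k \<bullet> x > 0"
      using S unfolding halfspace_cone_def subset_iff mem_Collect_eq not_all not_le not_imp Ball_def
      by blast
    have kI: "k \<in> I" using k K by blast
    have "orient a S k \<bullet> x \<le> 0" using x kI by (auto simp: halfspace_cone_def)
    \<comment> \<open>The vectors \<open>v k\<close> and \<open>orient a S k\<close> agree up to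
      sign, and \<open>x\<close> separates their signs, so they are opposite.\<close>
    then have opp: "v k = - orient a S k"
      using v[OF k(1)] k(2) by (auto simp: orient_def split: if_splits)
    have "?T \<inter> ?C S \<subseteq> {x. orient a S k \<bullet> x = 0}"
      using k(1) kI opp by (force simp: halfspace_cone_def)
    then have "interior (?T \<inter> ?C S) = {}"
      using interior_mono interior_hyperplane[OF or0[OF kI]] by blast
    then show ?thesis by (rule cone_angle_eq_0_if_interior_empty[OF \<alpha> TC])
  qed
  have "\<alpha> ?T = (\<Sum>S\<in>Pow I. \<alpha> (?T \<inter> ?C S))"
    using I \<alpha> T a0 by (rule cone_angle_sum_cells)
  also have "\<dots> = (\<Sum>S\<in>{S \<in> Pow I. ?O S \<noteq> {}}. \<alpha> (?T \<inter> ?C S))"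
    using I empty by (intro sum.mono_neutral_right) auto
  also have "\<dots> = (\<Sum>S\<in>{S \<in> Pow I. ?O S \<noteq> {}}. if ?C S \<subseteq> ?T then \<alpha> (?C S) else 0)"
    using outside by (intro sum.cong) (auto simp: Int_absorb1)
  also have "\<dots> = (\<Sum>R\<in>?C ` {S \<in> Pow I. ?O S \<noteq> {}}. if R \<subseteq> ?T then \<alpha> R else 0)"
    using sum.reindex[OF inj_on_halfspace_cone_orient, symmetric] by (simp only: o_def)
  finally show ?thesis unfolding closure_components_hyperplane_arrangement[OF I] .
qed

section \<open>Tangent cones\<close>

text \<open>In full dimension the affine hull imposes no constraint, and in a minimal family of
  half-spaces each boundary hyperplane cuts out a facet. The family is numbered to match the form of
  \<open>regions_eq\<close>.\<close>

lemma polyhedron_facet_description: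
  fixes P :: "'a::euclidean_space set"
  assumes "polyhedron P" "aff_dim P = int DIM('a)"
  obtains n and a :: "nat \<Rightarrow> 'a" and b where
    "P = {x. \<forall>k\<in>{1..n}. a k \<bullet> x \<le> b k}"
    "\<And>k. k \<in> {1..n} \<Longrightarrow> a k \<noteq> 0"
    "\<And>k. k \<in> {1..n} \<Longrightarrow> P \<inter> {x. a k \<bullet> x = b k} facet_of P"
proof -
  have hull: "affine hull P = UNIV" using assms(2) aff_dim_eq_full by blast
  obtain H where H: "finite H" "P = affine hull P \<inter> \<Inter> H"
      "\<forall>h\<in>H. \<exists>a b. a \<noteq> 0 \<and> h = {x. a \<bullet> x \<le> b}"
      "\<forall>H'\<subset>H. P \<subset> affine hull P \<inter> \<Inter> H'"
    using assms(1) polyhedron_Int_affine_minimal[of P] by auto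
  from H(3) obtain a b where ab: "\<And>h. h \<in> H \<Longrightarrow> a h \<noteq> 0 \<and> h = {x. a h \<bullet> x \<le> b h}" by metis
  obtain e where e: "bij_betw e {1..card H} H" using ex_bij_betw_nat_finite_1[OF H(1)] by blast
  then have eH: "e ` {1..card H} = H" by (simp add: bij_betw_def)
  have facet: "P \<inter> {x. a h \<bullet> x = b h} facet_of P" if "h \<in> H" for h
    using facet_of_polyhedron_explicit[OF H(1,2) ab] H(4) that by blast
  show thesis
  proof (rule that[of "card H" "a \<circ> e" "b \<circ> e"])
    \<comment> \<open>The equation in \<open>ab\<close> has \<open>h\<close> on both sides, so it is
      used pointwise rather than for rewriting.\<close>
    have "x \<in> h \<longleftrightarrow> a h \<bullet> x \<le> b h" if "h \<in> H" for h x
      using ab[OF that] by blast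
    then have "\<Inter> H = (\<Inter>h\<in>H. {x. a h \<bullet> x \<le> b h})" by blast
    then have "P = {x. \<forall>h\<in>H. a h \<bullet> x \<le> b h}" using H(2) hull by auto
    also have "\<dots> = {x. \<forall>h\<in>e ` {1..card H}. a h \<bullet> x \<le> b h}" by (simp only: eH)
    finally show "P = {x. \<forall>k\<in>{1..card H}. (a \<circ> e) k \<bullet> x \<le> (b \<circ> e) k}"
      by (simp only: ball_simps o_apply)
    show "(a \<circ> e) k \<noteq> 0" "P \<inter> {x. (a \<circ> e) k \<bullet> x = (b \<circ> e) k} facet_of P"
      if "k \<in> {1..card H}" for k
    proof -
      have "e k \<in> H" using that eH by blast
      then show "(a \<circ> e) k \<noteq> 0" "P \<inter> {x. (a \<circ> e) k \<bullet> x = (b \<circ> e) k} facet_of P"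
        using ab[of "e k"] facet[of "e k"] unfolding o_apply by blast+
    qed
  qed
qed

text \<open>Constraints tight at \<open>q\<close> restrict the direction; slack ones survive any
  sufficiently small step. Finiteness of \<open>I\<close> yields one step length that works for all
  constraints, expressed through the filter \<open>at_right 0\<close>.\<close>

lemma tangent_cone_eq_halfspace_cone:
  fixes P :: "'a::euclidean_space set"
  assumes P: "P = {x. \<forall>k\<in>I. a k \<bullet> x \<le> b k}" and I: "finite I"
    and F: "F face_of P" and q: "q \<in> rel_interior F"
  shows "tangent_cone F P = halfspace_cone a {k \<in> I. a k \<bullet> q = b k}"
proof -
  have "convex P" unfolding P
    by (auto simp: convex_def inner_add_right convex_bound_le)
  then have T: "tangent_cone F P = {x. \<exists>\<epsilon>>0. q + \<epsilon> *\<^sub>R x \<in> P}"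
    using F q by (rule tangent_cone_eq)
  have qP: "q \<in> P" using q F rel_interior_subset face_of_imp_subset by blast
  show ?thesis
  proof
    show "tangent_cone F P \<subseteq> halfspace_cone a {k \<in> I. a k \<bullet> q = b k}"
      unfolding T by (auto simp: P halfspace_cone_def inner_add_right mult_le_0_iff)
    show "halfspace_cone a {k \<in> I. a k \<bullet> q = b k} \<subseteq> tangent_cone F P"
    proof
      fix x assume x: "x \<in> halfspace_cone a {k \<in> I. a k \<bullet> q = b k}"
      have "\<forall>\<^sub>F \<epsilon> in at_right 0. a k \<bullet> (q + \<epsilon> *\<^sub>R x) \<le> b k" if k: "k \<in> I" for k
      proof (cases "a k \<bullet> q = b k")
        case True
        then have "a k \<bullet> x \<le> 0" using x k by (simp add: halfspace_cone_def)
        then show ?thesis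
          using True eventually_at_right_less[of "0::real"]
          by (auto elim!: eventually_mono simp: inner_add_right mult_le_0_iff)
      next
        case False
        then have "a k \<bullet> q < b k" using qP k P by force
        moreover have "((\<lambda>\<epsilon>. a k \<bullet> (q + \<epsilon> *\<^sub>R x)) \<longlongrightarrow> a k \<bullet> (q + 0 *\<^sub>R x)) (at_right 0)"
          by (intro tendsto_intros)
        ultimately have "\<forall>\<^sub>F \<epsilon> in at_right 0. a k \<bullet> (q + \<epsilon> *\<^sub>R x) < b k"
          by (auto dest: order_tendstoD(2))
        then show ?thesis by (rule eventually_mono) simp
      qed
      then have "\<forall>\<^sub>F \<epsilon> in at_right 0. \<forall>k\<in>I. a k \<bullet> (q + \<epsilon> *\<^sub>R x) \<le> b k"
        using I by (simp add: eventually_ball_finite)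
      then have "\<forall>\<^sub>F \<epsilon> in at_right 0. (0::real) < \<epsilon> \<and> q + \<epsilon> *\<^sub>R x \<in> P"
        using eventually_at_right_less[of "0::real"] by eventually_elim (simp add: P)
      then have "\<exists>\<epsilon>. (0::real) < \<epsilon> \<and> q + \<epsilon> *\<^sub>R x \<in> P"
        by (rule eventually_happens'[rotated]) simp
      then show "x \<in> tangent_cone F P" unfolding T by simp
    qed
  qed
qed

lemma in_image_uminus_iff: "x \<in> uminus ` A \<longleftrightarrow> - x \<in> A" for x :: "'a::group_add"
  by force

lemma inj_uminus_euclidean: "inj (uminus :: 'a::euclidean_space \<Rightarrow> 'a)"
  by (simp add: inj_on_def)

lemma face_of_uminus_iff:
  fixes P :: "'a::euclidean_space set"
  shows "uminus ` F face_of uminus ` P \<longleftrightarrow> F face_of P"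
  by (intro face_of_linear_image linear_uminus inj_uminus_euclidean)

text \<open>Negation is an injective linear map, so it carries relative interiors to relative
  interiors and \<open>- q\<close> can serve as base point of the negated face.\<close>

lemma tangent_cone_uminus:
  fixes P :: "'a::euclidean_space set"
  assumes "convex P" "F face_of P" "F \<noteq> {}"
  shows "tangent_cone (uminus ` F) (uminus ` P) = uminus ` tangent_cone F P"
proof -
  have "convex F" using assms(2) by (rule face_of_imp_convex)
  then obtain q where q: "q \<in> rel_interior F" using assms(3) rel_interior_eq_empty by blast
  have "- q \<in> rel_interior (uminus ` F)"
    using q rel_interior_injective_linear_image[OF bounded_linear_minus[OF bounded_linear_ident]
        inj_uminus_euclidean, of F] by auto
  then have "tangent_cone (uminus ` F) (uminus ` P) = {x. \<exists>\<epsilon>>0. - q + \<epsilon> *\<^sub>R x \<in> uminus ` P}"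
    using assms(1,2) by (intro tangent_cone_eq convex_negations) (auto simp: face_of_uminus_iff)
  also have "\<dots> = {x. \<exists>\<epsilon>>0. q + \<epsilon> *\<^sub>R (- x) \<in> P}"
    by (simp add: in_image_uminus_iff)
  also have "\<dots> = uminus ` {x. \<exists>\<epsilon>>0. q + \<epsilon> *\<^sub>R x \<in> P}"
    by (auto simp: in_image_uminus_iff)
  finally show ?thesis by (simp add: tangent_cone_eq[OF assms(1,2) q])
qed

text \<open>Negation matches the faces of the two polytopes and preserves dimension. After
  reindexing, both angle vectors are sums over the faces of \<open>P\<close> and can be added term
  by term.\<close>

lemma angle_vector_uminus:
  fixes P :: "'a::euclidean_space set"
  assumes "convex P"
  shows "angle_vector \<alpha> (uminus ` P) i =
    (if 0 \<le> i \<and> i \<le> int DIM('a) - 1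
     then \<Sum>F\<in>{F. F face_of P \<and> aff_dim F = i}. \<alpha> (uminus ` tangent_cone F P) else 0)"
proof (cases "0 \<le> i \<and> i \<le> int DIM('a) - 1")
  case True
  let ?\<F> = "{F. F face_of P \<and> aff_dim F = i}"
  have dim: "aff_dim (uminus ` F) = aff_dim F" for F :: "'a set"
    by (intro aff_dim_injective_linear_image linear_uminus inj_uminus_euclidean)
  have "{F. F face_of uminus ` P \<and> aff_dim F = i} = (`) uminus ` ?\<F>"
  proof (intro equalityI subsetI)
    fix G assume G: "G \<in> {F. F face_of uminus ` P \<and> aff_dim F = i}"
    have eq: "G = uminus ` uminus ` G" by (simp add: image_image)
    then have "uminus ` G \<in> ?\<F>" using G face_of_uminus_iff[of "uminus ` G" P] by (simp add: dim)
    then show "G \<in> (`) uminus ` ?\<F>" using eq by blast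
  qed (auto simp: face_of_uminus_iff dim)
  moreover have "inj_on ((`) uminus) ?\<F>"
    by (rule inj_onI) (simp only: inj_image_eq_iff[OF inj_uminus_euclidean])
  ultimately have "(\<Sum>F\<in>{F. F face_of uminus ` P \<and> aff_dim F = i}. \<alpha> (tangent_cone F (uminus ` P)))
      = (\<Sum>F\<in>?\<F>. \<alpha> (tangent_cone (uminus ` F) (uminus ` P)))"
    by (simp add: sum.reindex)
  also have "\<dots> = (\<Sum>F\<in>?\<F>. \<alpha> (uminus ` tangent_cone F P))"
    \<comment> \<open>The bound \<open>0 \<le> i\<close> rules out the empty face.\<close>
    using True assms by (intro sum.cong refl arg_cong[of _ _ \<alpha>] tangent_cone_uminus) auto
  finally show ?thesis using True by (simp add: angle_vector_def)
qed (auto simp: angle_vector_def)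

section \<open>Angles of tangent cones as sums over regions\<close>

text \<open>Supplies one explicit arrangement that describes both \<open>P\<close> and its regions,
  so that the results on sign patterns apply.\<close>

lemma regions_obtain:
  fixes P :: "'a::euclidean_space set"
  assumes "polyhedron P" "aff_dim P = int DIM('a)"
  obtains n and a :: "nat \<Rightarrow> 'a" and b where
    "P = {x. \<forall>k\<in>{1..n}. a k \<bullet> x \<le> b k}"
    "\<And>k. k \<in> {1..n} \<Longrightarrow> a k \<noteq> 0"
    "regions P = closure ` components (- (\<Union>k\<in>{1..n}. {x. a k \<bullet> x = 0}))"
proof (rule polyhedron_facet_description[OF assms])
  fix n and a :: "nat \<Rightarrow> 'a" and b
  assume ab: "P = {x. \<forall>k\<in>{1..n}. a k \<bullet> x \<le> b k}" "\<And>k. k \<in> {1..n} \<Longrightarrow> a k \<noteq> 0"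
    and facet: "\<And>k. k \<in> {1..n} \<Longrightarrow> P \<inter> {x. a k \<bullet> x = b k} facet_of P"
  have "regions P = closure ` components (- (\<Union>k\<in>{1..n}. {x. a k \<bullet> x = 0}))"
    using ab(1) facet assms(2) by (rule regions_eq[of P n a b])
  with ab show thesis by (rule that[of n a b])
qed

lemma finite_regions:
  fixes P :: "'a::euclidean_space set"
  assumes "polyhedron P" "aff_dim P = int DIM('a)"
  shows "finite (regions P)"
proof -
  obtain n and a :: "nat \<Rightarrow> 'a" and b where Peq: "P = {x. \<forall>k\<in>{1..n}. a k \<bullet> x \<le> b k}"
    and a0: "\<And>k. k \<in> {1..n} \<Longrightarrow> a k \<noteq> 0"
    and reg: "regions P = closure ` components (- (\<Union>k\<in>{1..n}. {x. a k \<bullet> x = 0}))"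
    by (rule regions_obtain[OF assms]) (rule that)
  show ?thesis unfolding reg closure_components_hyperplane_arrangement[OF finite_atLeastAtMost]
    by simp
qed

lemma region_polyhedral_cone:
  fixes P :: "'a::euclidean_space set"
  assumes "polyhedron P" "aff_dim P = int DIM('a)" "R \<in> regions P"
  shows "R \<in> polyhedral_cones"
proof -
  obtain n and a :: "nat \<Rightarrow> 'a" and b where Peq: "P = {x. \<forall>k\<in>{1..n}. a k \<bullet> x \<le> b k}"
    and a0: "\<And>k. k \<in> {1..n} \<Longrightarrow> a k \<noteq> 0"
    and reg: "regions P = closure ` components (- (\<Union>k\<in>{1..n}. {x. a k \<bullet> x = 0}))"
    by (rule regions_obtain[OF assms(1,2)]) (rule that)
  show ?thesis
    using assms(3)
    unfolding reg closure_components_hyperplane_arrangement[OF finite_atLeastAtMost]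
    by (auto intro: halfspace_cone_polyhedral)
qed

text \<open>The cone with no constraints is the whole space, of angle 1. Hence the angles of the
  regions can serve as convex weights.\<close>

lemma sum_cone_angle_regions:
  fixes P :: "'a::euclidean_space set"
  assumes "cone_angle \<alpha>" "polyhedron P" "aff_dim P = int DIM('a)"
  shows "(\<Sum>R\<in>regions P. \<alpha> R) = 1"
proof -
  obtain n and a :: "nat \<Rightarrow> 'a" and b where Peq: "P = {x. \<forall>k\<in>{1..n}. a k \<bullet> x \<le> b k}"
    and a0: "\<And>k. k \<in> {1..n} \<Longrightarrow> a k \<noteq> 0"
    and reg: "regions P = closure ` components (- (\<Union>k\<in>{1..n}. {x. a k \<bullet> x = 0}))"
    by (rule regions_obtain[OF assms(2,3)]) (rule that)
  have "\<alpha> (halfspace_cone a {}) = (\<Sum>R\<in>regions P. \<alpha> R)"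
    using cone_angle_sum_regions[where I = "{1..n}" and K = "{}" and v = a, OF _ assms(1) a0]
    unfolding reg by (simp add: halfspace_cone_def)
  then show ?thesis using assms(1) by (simp add: halfspace_cone_def cone_angle_def)
qed

text \<open>Since \<alpha> may change under negation, the sign is moved from the region to the cone:
  -R lies in T exactly when R lies in -T. Both terms then carry the same weight
  \<open>\<alpha> R\<close>.\<close>

lemma tangent_cone_angle_sum:
  fixes P :: "'a::euclidean_space set"
  assumes \<alpha>: "cone_angle \<alpha>" and P: "polyhedron P" "aff_dim P = int DIM('a)"
    and F: "F face_of P" "F \<noteq> P" "F \<noteq> {}"
  shows "\<alpha> (tangent_cone F P) + \<alpha> (uminus ` tangent_cone F P) =
    (\<Sum>R\<in>regions P. if R \<subseteq> tangent_cone F P \<or> uminus ` R \<subseteq> tangent_cone F P then \<alpha> R else 0)"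
proof -
  obtain n and a :: "nat \<Rightarrow> 'a" and b where Peq: "P = {x. \<forall>k\<in>{1..n}. a k \<bullet> x \<le> b k}"
    and a0: "\<And>k. k \<in> {1..n} \<Longrightarrow> a k \<noteq> 0"
    and reg: "regions P = closure ` components (- (\<Union>k\<in>{1..n}. {x. a k \<bullet> x = 0}))"
    by (rule regions_obtain[OF P]) (rule that)
  obtain q where q: "q \<in> rel_interior F"
    using F face_of_imp_convex rel_interior_eq_empty by blast
  define K where "K = {k \<in> {1..n}. a k \<bullet> q = b k}"
  have KI: "K \<subseteq> {1..n}" by (auto simp: K_def)
  let ?T = "tangent_cone F P"
  have T: "?T = halfspace_cone a K"
    unfolding K_def using Peq F(1) q by (intro tangent_cone_eq_halfspace_cone) auto
  then have mT: "uminus ` ?T = halfspace_cone (\<lambda>k. - a k) K"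
    by (auto simp: halfspace_cone_def in_image_uminus_iff)
  \<comment> \<open>With no tight constraint \<open>q\<close> would be interior to \<open>P\<close>,
    but a proper face misses the interior.\<close>
  have "K \<noteq> {}"
  proof
    assume "K = {}"
    have qP: "q \<in> F" "q \<in> P" using q F rel_interior_subset face_of_imp_subset by blast+
    let ?J = "\<Inter>k\<in>{1..n}. {x. a k \<bullet> x < b k}"
    have "a k \<bullet> q < b k" if k: "k \<in> {1..n}" for k
    proof -
      have "a k \<bullet> q \<le> b k" using qP(2) k unfolding Peq by blast
      moreover have "a k \<bullet> q \<noteq> b k" using \<open>K = {}\<close> k unfolding K_def by blast
      ultimately show ?thesis by simp
    qed
    then have "q \<in> ?J" by blast
    moreover have "open ?J" by (intro open_INT) (auto simp: open_halfspace_lt)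
    moreover have "?J \<subseteq> P" unfolding Peq by force
    ultimately have "q \<in> interior P" by (meson interiorI)
    then show False using face_of_disjoint_interior[OF F(1,2)] qP by blast
  qed
  then obtain j where j: "j \<in> K" by blast
  \<comment> \<open>A region contains a point off all hyperplanes; lying in both cones would put
    that point on the hyperplane of the tight index \<open>j\<close>.\<close>
  have excl: "\<not> (R \<subseteq> ?T \<and> R \<subseteq> uminus ` ?T)" if Rreg: "R \<in> regions P" for R
  proof
    assume R: "R \<subseteq> ?T \<and> R \<subseteq> uminus ` ?T"
    obtain X where X: "R = closure X" "X \<in> components (- (\<Union>k\<in>{1..n}. {x. a k \<bullet> x = 0}))"
      using Rreg reg by blast
    then obtain x where x: "x \<in> X" using in_components_nonempty by blast
    then have "x \<notin> (\<Union>k\<in>{1..n}. {x. a k \<bullet> x = 0})"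
      using in_components_subset[OF X(2)] by blast
    then have "a j \<bullet> x \<noteq> 0" using j KI by blast
    moreover have "x \<in> R" using x X(1) closure_subset by blast
    moreover have "R \<subseteq> halfspace_cone a K" "R \<subseteq> halfspace_cone (\<lambda>k. - a k) K"
      using R T mT by auto
    ultimately have "a j \<bullet> x \<le> 0" "- a j \<bullet> x \<le> 0"
      using j unfolding halfspace_cone_def by blast+
    then show False using \<open>a j \<bullet> x \<noteq> 0\<close> by simp
  qed
  have neg: "uminus ` R \<subseteq> ?T \<longleftrightarrow> R \<subseteq> uminus ` ?T" for R
    by (auto simp: in_image_uminus_iff)
  have "\<alpha> ?T = (\<Sum>R\<in>regions P. if R \<subseteq> ?T then \<alpha> R else 0)"
    unfolding T reg using KI a0 by (intro cone_angle_sum_regions \<alpha>) auto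
  moreover have "\<alpha> (uminus ` ?T) = (\<Sum>R\<in>regions P. if R \<subseteq> uminus ` ?T then \<alpha> R else 0)"
    unfolding mT reg using KI a0 by (intro cone_angle_sum_regions \<alpha>) auto
  ultimately have "\<alpha> ?T + \<alpha> (uminus ` ?T) = (\<Sum>R\<in>regions P.
      (if R \<subseteq> ?T then \<alpha> R else 0) + (if R \<subseteq> uminus ` ?T then \<alpha> R else 0))"
    by (simp only: sum.distrib)
  also have "\<dots> = (\<Sum>R\<in>regions P. if R \<subseteq> ?T \<or> uminus ` R \<subseteq> ?T then \<alpha> R else 0)"
  proof (rule sum.cong[OF refl])
    fix R assume "R \<in> regions P"
    from excl[OF this]
    show "(if R \<subseteq> ?T then \<alpha> R else 0) + (if R \<subseteq> uminus ` ?T then \<alpha> R else 0) =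
        (if R \<subseteq> ?T \<or> uminus ` R \<subseteq> ?T then \<alpha> R else 0)"
      unfolding neg by simp
  qed
  finally show ?thesis .
qed

text \<open>The tangent cone of the empty face is \<open>{0}\<close>, so this says that every region
  cuts that face. A region contains a nonempty open set, and \<open>{0}\<close> is not open.\<close>

lemma region_not_subset_singleton_0:
  fixes P :: "'a::euclidean_space set"
  assumes "R \<in> regions P" "polyhedron P" "aff_dim P = int DIM('a)"
  shows "\<not> R \<subseteq> {0}"
proof
  assume "R \<subseteq> {0}"
  obtain n and a :: "nat \<Rightarrow> 'a" and b where Peq: "P = {x. \<forall>k\<in>{1..n}. a k \<bullet> x \<le> b k}"
    and a0: "\<And>k. k \<in> {1..n} \<Longrightarrow> a k \<noteq> 0"
    and reg: "regions P = closure ` components (- (\<Union>k\<in>{1..n}. {x. a k \<bullet> x = 0}))"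
      (is "_ = _ ` components ?U")
    by (rule regions_obtain[OF assms(2,3)]) (rule that)
  obtain X where X: "X \<in> components ?U" "R = closure X" using assms(1) unfolding reg by blast
  have "open ?U"
    by (intro open_Compl closed_UN) (auto simp: closed_hyperplane)
  then have "open X" "X \<noteq> {}" using X(1) open_components in_components_nonempty by blast+
  moreover have "X \<subseteq> {0}" using X(2) closure_subset[of X] \<open>R \<subseteq> {0}\<close> by simp
  ultimately show False using not_open_singleton[of "0::'a"] by (metis subset_singletonD)
qed

theorem theorem2p7:
  fixes \<alpha> :: "'a::euclidean_space set \<Rightarrow> real" and P :: "'a set"
  assumes "nonneg_cone_angle \<alpha>"
    and "polytope P" and "aff_dim P = int DIM('a)"
  shows "angle_vector \<alpha> P + angle_vector \<alpha> (uminus ` P)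
    \<in> convex hull {f_vector (proper_faces P) - f_vector (cut_faces R P) | R. R \<in> regions P}"
proof -
  let ?g = "\<lambda>R. f_vector (proper_faces P) - f_vector (cut_faces R P)"
  let ?uncut = "\<lambda>R F. R \<subseteq> tangent_cone F P \<or> uminus ` R \<subseteq> tangent_cone F P"
  have \<alpha>: "cone_angle \<alpha>" and nonneg: "\<And>C. C \<in> polyhedral_cones \<Longrightarrow> 0 \<le> \<alpha> C"
    using assms(1) by (auto simp: nonneg_cone_angle_def)
  have P: "polyhedron P" "convex P"
    using assms(2) by (auto intro: polytope_imp_polyhedron polytope_imp_convex)
  have finF: "finite {F. F face_of P \<and> aff_dim F = i}" for i
    using finite_subset[OF _ finite_polytope_faces[OF assms(2)]] by auto
  \<comment> \<open>The generator counts the faces not cut by \<open>R\<close>. Dimension at most d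
    - 1 already excludes \<open>P\<close> itself, so properness need not be recorded in the index
    set.\<close>
  have g: "?g R i = (\<Sum>F\<in>{F. F face_of P \<and> aff_dim F = i}. if ?uncut R F then 1 else 0)"
    if i: "-1 \<le> i" "i \<le> int DIM('a) - 1" for R i
  proof -
    let ?\<F> = "{F. F face_of P \<and> aff_dim F = i}"
    have eq: "{F \<in> proper_faces P. aff_dim F = i} = ?\<F>"
      using i assms(3) by (auto simp: proper_faces_def)
    have "{F \<in> cut_faces R P. aff_dim F = i} = ?\<F> - {F \<in> ?\<F>. ?uncut R F}"
      using i assms(3) by (auto simp: cut_faces_def proper_faces_def)
    moreover have "{F \<in> ?\<F>. ?uncut R F} \<subseteq> ?\<F>" by blast
    ultimately have "real (card {F \<in> cut_faces R P. aff_dim F = i}) =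
        real (card ?\<F>) - real (card {F \<in> ?\<F>. ?uncut R F})"
      using finF by (metis (no_types, lifting) card_Diff_subset card_mono finite_subset of_nat_diff)
    then have "?g R i = real (card {F \<in> ?\<F>. ?uncut R F})"
      using i eq by (simp add: f_vector_def)
    also have "\<dots> = (\<Sum>F\<in>?\<F>. if ?uncut R F then 1 else 0)"
      using finF by (simp add: sum.If_cases Int_def)
    finally show ?thesis .
  qed
  have "(angle_vector \<alpha> P + angle_vector \<alpha> (uminus ` P)) i = (\<Sum>R\<in>regions P. \<alpha> R *\<^sub>R ?g R) i" for i
  proof -
    let ?\<F> = "{F. F face_of P \<and> aff_dim F = i}"
    have rhs: "(\<Sum>R\<in>regions P. \<alpha> R *\<^sub>R ?g R) i = (\<Sum>R\<in>regions P. \<alpha> R * ?g R i)"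
      by (simp add: sum_fun_apply scaleR_fun_def)
    consider "0 \<le> i" "i \<le> int DIM('a) - 1" | "i = -1" | "i < -1 \<or> i > int DIM('a) - 1"
      by linarith
    then show ?thesis
    proof cases
      case 1
      have "(angle_vector \<alpha> P + angle_vector \<alpha> (uminus ` P)) i =
          (\<Sum>F\<in>?\<F>. \<alpha> (tangent_cone F P) + \<alpha> (uminus ` tangent_cone F P))"
        using 1 by (simp add: angle_vector_uminus[OF P(2)] angle_vector_def[of \<alpha> P] sum.distrib)
      \<comment> \<open>The range of \<open>i\<close> makes every face in the sum nonempty and
        proper.\<close>
      also have "\<dots> = (\<Sum>F\<in>?\<F>. \<Sum>R\<in>regions P. if ?uncut R F then \<alpha> R else 0)"
        using 1 assms(3) by (intro sum.cong refl tangent_cone_angle_sum[OF \<alpha> P(1) assms(3)]) auto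
      also have "\<dots> = (\<Sum>R\<in>regions P. \<Sum>F\<in>?\<F>. if ?uncut R F then \<alpha> R else 0)"
        by (rule sum.swap)
      also have "\<dots> = (\<Sum>R\<in>regions P. \<alpha> R * ?g R i)"
      proof (rule sum.cong[OF refl])
        fix R
        have "?g R i = (\<Sum>F\<in>?\<F>. if ?uncut R F then 1 else 0)" using 1 by (intro g) auto
        then show "(\<Sum>F\<in>?\<F>. if ?uncut R F then \<alpha> R else 0) = \<alpha> R * ?g R i"
          by (simp only: sum_distrib_left mult.right_neutral mult_zero_right if_distrib[of "(*) (\<alpha> R)"])
      qed
      finally show ?thesis by (simp add: rhs)
    next
      case 2
      \<comment> \<open>The angle vectors vanish at -1 by convention; on the other side the empty
        face is counted in both f-vectors and cancels.\<close>
      have "?g R i = 0" if R: "R \<in> regions P" for R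
      proof -
        have "R \<noteq> {}"
          using region_not_subset_singleton_0[OF R P(1) assms(3)] by blast
        then have "\<not> ?uncut R {}"
          using region_not_subset_singleton_0[OF R P(1) assms(3)]
          by (auto simp: tangent_cone_def)
        then have "\<not> ?uncut R F" if "aff_dim F = -1" for F
          using that aff_dim_empty[of F] by simp
        then have "(\<Sum>F\<in>?\<F>. if ?uncut R F then 1 else 0) = (0::real)"
          using 2 by (intro sum.neutral) simp
        then show ?thesis using 2 by (subst g) simp_all
      qed
      then show ?thesis unfolding rhs using 2 by (simp add: angle_vector_def)
    next
      case 3
      then show ?thesis by (auto simp: rhs angle_vector_def f_vector_def)
    qed
  qed
  then have "angle_vector \<alpha> P + angle_vector \<alpha> (uminus ` P) = (\<Sum>R\<in>regions P. \<alpha> R *\<^sub>R ?g R)"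
    by blast
  \<comment> \<open>The angles of the regions are the weights: nonnegative by assumption, with sum
    1.\<close>
  also have "\<dots> \<in> convex hull {?g R | R. R \<in> regions P}"
  proof (rule convex_sum)
    show "finite (regions P)" using P(1) assms(3) by (rule finite_regions)
    show "sum \<alpha> (regions P) = 1" using \<alpha> P(1) assms(3) by (rule sum_cone_angle_regions)
    show "0 \<le> \<alpha> R" if "R \<in> regions P" for R
      using nonneg region_polyhedral_cone[OF P(1) assms(3) that] by blast
    show "?g R \<in> convex hull {?g R | R. R \<in> regions P}" if "R \<in> regions P" for R
      using that by (intro hull_inc) blast
  qed (rule convex_convex_hull)
  finally show ?thesis .
qed

end
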